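(* Let $(\mathbb{T},\log,\partial,\circ,x)$, with $\mathbb{T}=\mathbf{R}[[\mathfrak{N}]]$, be a structure satisfying conditions (i)–(viii) of the context, and assume that any two $f,g\in\mathbb{T}^{>\mathbf{R}}$ with $f,g>x$ are conjugate in the group $(\mathbb{T}^{>\mathbf{R}},\circ,x)$. Then for all $f\in\mathbb{T}^{>\mathbf{R}}$ with $f\neq x$, there is an isomorphism of ordered groups $(\mathcal{C}(f),\circ,x,<)\simeq(\mathbf{R},+,0,<)$, where $\mathcal{C}(f)=\{h\in\mathbb{T}^{>\mathbf{R}}:h\circ f=f\circ h\}$.
   Context: Well-based series. The set theory is NBG; groups and fields may be proper classes. For an ordered field $\mathbf{R}$ and a linearly ordered abelian group $(\mathfrak{N},\cdot,1,\prec)$, $\mathbf{R}[[\mathfrak{N}]]$ is the ordered field of functions $s:\mathfrak{N}\to\mathbf{R}$ whose support $\operatorname{supp}s$ is a set well-ordered for $\succ$, with pointwise sum and Cauchy product; $s>0$ iff $s\neq0$ and $s(\max\operatorname{supp}s)>0$. Monomials (elements of $\mathfrak{N}$) and elements of $\mathbf{R}$ are identified with series. For $s\neq0$, $\mathfrak{d}(s)=\max\operatorname{supp}s$. $s\prec t$ means $r|s|<|t|$ for all $r\in\mathbf{R}^{>}$; $s\preccurlyeq t$ means not $t\prec s$. $\mathbb{T}_{\succ}=\{s:\operatorname{supp}s\succ1\}$ and $\mathbb{T}^{>\mathbf{R}}=\mathbb{T}^{>,\succ}=\{s:s>\mathbf{R}\}$. A family $(s_i)$ is summable if $\bigcup_i\operatorname{supp}s_i$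 is a set well-ordered by $\succ$ and each monomial lies in finitely many $\operatorname{supp}s_i$; an $\mathbf{R}$-linear map is strongly linear if it preserves summability and commutes with sums of summable families. When $\log$ is given, for $s,t\in\mathbb{T}^\times$: $s\prec\!\!\prec t$ iff $\log|s|\prec\log|t|$; $s\preccurlyeq\!\!\preccurlyeq t$ iff $\log|s|\preccurlyeq\log|t|$. Write $f'=\partial(f)$, $f^{(k)}=\partial^k(f)$. Conditions. (i) $\mathfrak{N}$ is a linearly ordered abelian group, $\mathbf{R}$ an ordered field, $\mathbb{T}=\mathbf{R}[[\mathfrak{N}]]$. (ii) $(\mathbb{T},\log)$ is an exponentially closed transserial field: $\log:(\mathbb{T}^{>},\cdot,1,<)\to(\mathbb{T},+,0,<)$ is an isomorphism of ordered groups, $\log\mathfrak{N}\subseteq\mathbb{T}_{\succ}$, $\log s\leqslant s-1$ for $s\in\mathbb{T}^{>}$, $\log(1+\varepsilon)=\sum_{k>0}\frac{(-1)^{k+1}}{k}\varepsilon^k$ for $\varepsilon\prec1$, and $\log$ restricts to an isomorphism $(\mathbf{R}^{>},\cdot,<)\to(\mathbf{R},+,<)$. (iii) $\partial:\mathbb{T}\to\mathbb{T}$ is a surjective transserial derivation (strongly linear, Leibniz rule, $\partial(\log|s|)=\partial(s)/s$ for $s\neq0$), with identity $x\in\mathfrak{N}$ ($x>0$, $x \neq 1$, $\partial(x)=1$), which is flat: for $\mathfrak{m}\in\mathfrak{N}$ and $\mathfrak{n}\in\operatorname{supp}\partial(\mathfrak{m})$ there are $\mathfrak{f},\mathfrak{w}\in\mathfrak{N}$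 with $\mathfrak{f}\prec\!\!\prec\mathfrak{m}$, $\mathfrak{w}\preccurlyeq\!\!\preccurlyeq x$, $\mathfrak{n}=\mathfrak{m}\mathfrak{f}\mathfrak{w}$. (iv) $(\mathbb{T},\partial)$ is an H-field: $\ker\partial=\mathbf{R}$ and $f'>0$ for $f\in\mathbb{T}^{>,\succ}$. (v) $\circ:\mathbb{T}\times\mathbb{T}^{>,\succ}\to\mathbb{T}$ is a transserial composition law (each $f\mapsto f\circ s$ is a strongly linear morphism of ordered rings commuting with $\log$, and $f\circ(s\circ t)=(f\circ s)\circ t$) with identity $x$ ($x\circ s=s$, $f\circ x=f$), which is flat: for $s\in\mathbb{T}^{>,\succ}$, $\mathfrak{m}\in\mathfrak{N}\setminus\{1\}$, $\mathfrak{n}\in\operatorname{supp}(\mathfrak{m}\circ s)$ there are $\mathfrak{f},\mathfrak{w}\in\mathfrak{N}$, $\mathfrak{u}\in\operatorname{supp}s$ with $\mathfrak{f}\prec\!\!\prec\mathfrak{m}$, $\mathfrak{w}\preccurlyeq1$, $\mathfrak{w}\preccurlyeq\!\!\preccurlyeq\mathfrak{u}$, $\mathfrak{n}=\mathfrak{d}(\mathfrak{m}\circ s)\mathfrak{f}\mathfrak{w}$. (vi) Chain rule $(f\circ s)'=s'(f'\circ s)$; and Taylor expansions: whenever $s\in\mathbb{T}^{>,\succ}$, $\delta\prec s$, and $(\mathfrak{m}'\circ s)\delta\prec\mathfrak{m}\circ s$ for all $\mathfrak{m}\in\operatorname{supp}f$, the family $((\mathfrak{m}^{(k)}\circ s)\delta^k)_{\mathfrak{m}\in\operatorname{supp}f,k\in\mathbb{N}}$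 is summable, $f\circ(s+\delta)=\sum_k\frac{f^{(k)}\circ s}{k!}\delta^k=\sum_{\mathfrak{m},k}f(\mathfrak{m})\frac{\mathfrak{m}^{(k)}\circ s}{k!}\delta^k$, and $(f^{(k)}\circ s)\delta^k\succ(f^{(k+1)}\circ s)\delta^{k+1}$ whenever the left side is nonzero. (vii) $(\mathbb{T}^{>,\succ},\circ,x)$ is a group. (viii) Monotonicity: for $f\in\mathbb{T}\setminus\mathbf{R}$, the map $s\mapsto f\circ s$ on $\mathbb{T}^{>,\succ}$ is strictly increasing if $f'>0$ and strictly decreasing if $f'<0$. Under these conditions $(\mathbb{T}^{>\mathbf{R}},\circ,x,<)$ is a linearly bi-ordered group. Elements $f,g$ are conjugate if $h\circ f=g\circ h$ for some $h\in\mathbb{T}^{>\mathbf{R}}$. *)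

theory Defs
  imports "HOL-Algebra.Group"
begin

unbundle cardinal_syntax

text \<open>
  The ambient NBG set theory is rendered as follows. The monomial group and the coefficient field,
  which may be proper classes, are types. A class counts as a set if it has fewer than
  \<open>\<kappa>\<close> elements, where \<open>\<kappa>\<close> is a regular uncountable cardinal; \<open>\<kappa>\<close> is a parameter. The intended
  instance is the cardinality of the universe of sets. The bound cannot be omitted: if all
  well-ordered subsets of a nontrivial monomial group were admitted as supports, then no exponentially
  closed transserial field would exist, by a theorem of F.-V. Kuhlmann, S. Kuhlmann and S. Shelah.
\<close>

definition regular_uncountable :: "'k rel \<Rightarrow> bool" where
  "regular_uncountable \<kappa> \<longleftrightarrow> Card_order \<kappa> \<and> regularCard \<kappa> \<and> natLeq <o \<kappa>"

class linordered_ab_group_mult = comm_monoid_mult + inverse + linorder +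
  assumes group_left_inverse: "inverse a * a = 1"
    and group_divide_inverse: "a / b = a * inverse b"
    and group_mult_left_mono: "a \<le> b \<Longrightarrow> c * a \<le> c * b"


section \<open>Series\<close>

text \<open>
  The type \<open>('n, 'r) series\<close> contains all functions from monomials to coefficients. The operations
  and relations on it have their intended meaning only on the subset \<open>wb_series \<kappa>\<close> of well-based
  series, which is the field \<open>R[[N]]\<close>.
\<close>

datatype ('n, 'r) series = Series (coeff: "'n \<Rightarrow> 'r")

definition supp :: "('n, 'r::zero) series \<Rightarrow> 'n set" where
  "supp s = {n. coeff s n \<noteq> 0}"

definition wb_set :: "'k rel \<Rightarrow> 'n::linorder set \<Rightarrow> bool" where
  "wb_set \<kappa> S \<longleftrightarrow> wfp_on S (>) \<and> |S| <o \<kappa>"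

definition wb_series :: "'k rel \<Rightarrow> ('n::linorder, 'r::zero) series set" where
  "wb_series \<kappa> = {s. wb_set \<kappa> (supp s)}"

definition dmon :: "('n::linorder, 'r::zero) series \<Rightarrow> 'n" where
  "dmon s = (GREATEST n. n \<in> supp s)"

definition const :: "'r \<Rightarrow> ('n::one, 'r::zero) series" where
  "const r = Series (\<lambda>n. if n = 1 then r else 0)"

definition monom :: "'n \<Rightarrow> ('n, 'r::zero_neq_one) series" where
  "monom m = Series (\<lambda>n. if n = m then 1 else 0)"

definition scale :: "'r \<Rightarrow> ('n, 'r::times) series \<Rightarrow> ('n, 'r) series" where
  "scale r s = Series (\<lambda>n. r * coeff s n)"

instantiation series ::
  (linordered_ab_group_mult, linordered_field) "{zero, plus, minus, uminus, power, ord, abs}"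
begin

definition "0 = Series (\<lambda>n::'a. 0::'b)"

definition "s + t = Series (\<lambda>n::'a. coeff s n + coeff t n :: 'b)"

definition "s - t = Series (\<lambda>n::'a. coeff s n - coeff t n :: 'b)"

definition "- s = Series (\<lambda>n::'a. - coeff s n :: 'b)"

definition "1 = (const 1 :: ('a, 'b) series)"

text \<open>For well-based \<open>s\<close> and \<open>t\<close> the index set below is finite.\<close>

definition "s * t = Series (\<lambda>n::'a.
  \<Sum>(a, b) | a \<in> supp s \<and> b \<in> supp t \<and> a * b = n. coeff s a * coeff t b :: 'b)"

definition "s < t \<longleftrightarrow>
  t - s \<noteq> (0 :: ('a, 'b) series) \<and> 0 < coeff (t - s) (dmon (t - s))"

definition "s \<le> t \<longleftrightarrow> s < t \<or> s = (t :: ('a, 'b) series)"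

definition "\<bar>s\<bar> = (if s < 0 then - s else s :: ('a, 'b) series)"

instance ..

end

type_synonym ('n, 'r) series_op = "('n, 'r) series \<Rightarrow> ('n, 'r) series"


subsection \<open>Asymptotic relations\<close>

definition dominated :: "('n::linordered_ab_group_mult, 'r::linordered_field) series
    \<Rightarrow> ('n, 'r) series \<Rightarrow> bool" (infix \<open>\<prec>\<close> 50) where
  "s \<prec> t \<longleftrightarrow> (\<forall>r>0. scale r \<bar>s\<bar> < \<bar>t\<bar>)"

definition dominated_eq :: "('n::linordered_ab_group_mult, 'r::linordered_field) series
    \<Rightarrow> ('n, 'r) series \<Rightarrow> bool" (infix \<open>\<preceq>\<close> 50) where
  "s \<preceq> t \<longleftrightarrow> \<not> t \<prec> s"

definition flatter :: "('n::linordered_ab_group_mult, 'r::linordered_field) series_op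
    \<Rightarrow> ('n, 'r) series \<Rightarrow> ('n, 'r) series \<Rightarrow> bool" where
  "flatter lg s t \<longleftrightarrow> lg \<bar>s\<bar> \<prec> lg \<bar>t\<bar>"

definition flatter_eq :: "('n::linordered_ab_group_mult, 'r::linordered_field) series_op
    \<Rightarrow> ('n, 'r) series \<Rightarrow> ('n, 'r) series \<Rightarrow> bool" where
  "flatter_eq lg s t \<longleftrightarrow> lg \<bar>s\<bar> \<preceq> lg \<bar>t\<bar>"

definition positive :: "'k rel \<Rightarrow>
    ('n::linordered_ab_group_mult, 'r::linordered_field) series set" where
  "positive \<kappa> = {s \<in> wb_series \<kappa>. 0 < s}"

definition purely_infinite :: "'k rel \<Rightarrow>
    ('n::linordered_ab_group_mult, 'r::linordered_field) series set" where
  "purely_infinite \<kappa> = {s \<in> wb_series \<kappa>. \<forall>n\<in>supp s. 1 < n}"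

definition pos_infinite :: "'k rel \<Rightarrow>
    ('n::linordered_ab_group_mult, 'r::linordered_field) series set" where
  "pos_infinite \<kappa> = {s \<in> wb_series \<kappa>. \<forall>r. const r < s}"


subsection \<open>Summable families\<close>

definition summable_family :: "'k rel \<Rightarrow> 'i set
    \<Rightarrow> ('i \<Rightarrow> ('n::linordered_ab_group_mult, 'r::linordered_field) series) \<Rightarrow> bool" where
  "summable_family \<kappa> I s \<longleftrightarrow>
     wb_set \<kappa> (\<Union>i\<in>I. supp (s i)) \<and> (\<forall>n. finite {i \<in> I. n \<in> supp (s i)})"

definition family_sum :: "'i set
    \<Rightarrow> ('i \<Rightarrow> ('n::linordered_ab_group_mult, 'r::linordered_field) series)
    \<Rightarrow> ('n, 'r) series" where
  "family_sum I s = Series (\<lambda>n. \<Sum>i | i \<in> I \<and> n \<in> supp (s i). coeff (s i) n)"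

definition sums_to :: "'k rel \<Rightarrow> 'i set
    \<Rightarrow> ('i \<Rightarrow> ('n::linordered_ab_group_mult, 'r::linordered_field) series)
    \<Rightarrow> ('n, 'r) series \<Rightarrow> bool" where
  "sums_to \<kappa> I s t \<longleftrightarrow> summable_family \<kappa> I s \<and> family_sum I s = t"

text \<open>
  The index type \<open>'n \<times> nat\<close> is no restriction: choosing a monomial in the support of each nonzero
  member of a summable family is a finite-to-one map into the monomials, so the nonzero members
  can be indexed by a subset of \<open>'n \<times> nat\<close>, and zero members affect neither summability nor the sum.
\<close>

definition strongly_linear ::
  "'k rel \<Rightarrow> ('n::linordered_ab_group_mult, 'r::linordered_field) series_op \<Rightarrow> bool" where
  "strongly_linear \<kappa> \<phi> \<longleftrightarrow>
     (\<forall>s\<in>wb_series \<kappa>. \<phi> s \<in> wb_series \<kappa>) \<and>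
     (\<forall>s\<in>wb_series \<kappa>. \<forall>t\<in>wb_series \<kappa>. \<phi> (s + t) = \<phi> s + \<phi> t) \<and>
     (\<forall>r. \<forall>s\<in>wb_series \<kappa>. \<phi> (scale r s) = scale r (\<phi> s)) \<and>
     (\<forall>(I :: ('n \<times> nat) set) s. summable_family \<kappa> I s \<longrightarrow>
        sums_to \<kappa> I (\<lambda>i. \<phi> (s i)) (\<phi> (family_sum I s)))"


section \<open>Transserial fields\<close>

definition ordered_group_iso ::
  "('a::ord) monoid \<Rightarrow> ('b::ord) monoid \<Rightarrow> ('a \<Rightarrow> 'b) \<Rightarrow> bool" where
  "ordered_group_iso G H \<phi> \<longleftrightarrow> group G \<and> group H \<and> \<phi> \<in> iso G H \<and>
     (\<forall>a\<in>carrier G. \<forall>b\<in>carrier G. a < b \<longleftrightarrow> \<phi> a < \<phi> b)"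

definition exp_closed_transserial_field ::
  "'k rel \<Rightarrow> ('n::linordered_ab_group_mult, 'r::linordered_field) series_op \<Rightarrow> bool" where
  "exp_closed_transserial_field \<kappa> lg \<longleftrightarrow>
     ordered_group_iso
       \<lparr>carrier = positive \<kappa>, mult = (*), one = 1\<rparr>
       \<lparr>carrier = wb_series \<kappa>, mult = (+), one = 0\<rparr> lg \<and>
     (\<forall>m. lg (monom m) \<in> purely_infinite \<kappa>) \<and>
     (\<forall>s\<in>positive \<kappa>. lg s \<le> s - 1) \<and>
     (\<forall>\<epsilon>\<in>wb_series \<kappa>. \<epsilon> \<prec> 1 \<longrightarrow>
        sums_to \<kappa> {k::nat. 0 < k} (\<lambda>k. scale ((- 1) ^ (k + 1) / of_nat k) (\<epsilon> ^ k)) (lg (1 + \<epsilon>))) \<and>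
     ordered_group_iso
       \<lparr>carrier = const ` {r::'r. 0 < r}, mult = (*), one = 1\<rparr>
       \<lparr>carrier = range (const :: 'r \<Rightarrow> ('n, 'r) series), mult = (+), one = 0\<rparr> lg"

definition transserial_derivation ::
  "'k rel \<Rightarrow> ('n::linordered_ab_group_mult, 'r::linordered_field) series_op
    \<Rightarrow> ('n, 'r) series_op \<Rightarrow> bool" where
  "transserial_derivation \<kappa> lg D \<longleftrightarrow>
     strongly_linear \<kappa> D \<and>
     (\<forall>s\<in>wb_series \<kappa>. \<forall>t\<in>wb_series \<kappa>. D (s * t) = D s * t + s * D t) \<and>
     (\<forall>s\<in>wb_series \<kappa>. s \<noteq> 0 \<longrightarrow> D (lg \<bar>s\<bar>) * s = D s)"

definition flat_derivation ::
  "('n::linordered_ab_group_mult, 'r::linordered_field) series_op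
    \<Rightarrow> ('n, 'r) series_op \<Rightarrow> 'n \<Rightarrow> bool" where
  "flat_derivation lg D x \<longleftrightarrow>
     (\<forall>m. \<forall>n\<in>supp (D (monom m)). \<exists>f w.
        flatter lg (monom f) (monom m) \<and> flatter_eq lg (monom w) (monom x) \<and> n = m * f * w)"

definition surjective_flat_transserial_derivation ::
  "'k rel \<Rightarrow> ('n::linordered_ab_group_mult, 'r::linordered_field) series_op
    \<Rightarrow> ('n, 'r) series_op \<Rightarrow> 'n \<Rightarrow> bool" where
  "surjective_flat_transserial_derivation \<kappa> lg D x \<longleftrightarrow>
     transserial_derivation \<kappa> lg D \<and> D ` wb_series \<kappa> = wb_series \<kappa> \<and>
     (0 :: ('n, 'r) series) < monom x \<and> x \<noteq> 1 \<and> D (monom x) = 1 \<and>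
     flat_derivation lg D x"

definition H_field ::
  "'k rel \<Rightarrow> ('n::linordered_ab_group_mult, 'r::linordered_field) series_op \<Rightarrow> bool" where
  "H_field \<kappa> D \<longleftrightarrow>
     {f \<in> wb_series \<kappa>. D f = 0} = range const \<and> (\<forall>f\<in>pos_infinite \<kappa>. 0 < D f)"


section \<open>Composition\<close>

definition transserial_composition ::
  "'k rel \<Rightarrow> ('n::linordered_ab_group_mult, 'r::linordered_field) series_op
    \<Rightarrow> (('n, 'r) series \<Rightarrow> ('n, 'r) series_op) \<Rightarrow> 'n \<Rightarrow> bool" where
  "transserial_composition \<kappa> lg cmp x \<longleftrightarrow>
     (\<forall>s\<in>pos_infinite \<kappa>.
        strongly_linear \<kappa> (\<lambda>f. cmp f s) \<and>
        cmp 1 s = 1 \<and>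
        (\<forall>f\<in>wb_series \<kappa>. \<forall>g\<in>wb_series \<kappa>. cmp (f * g) s = cmp f s * cmp g s) \<and>
        (\<forall>f\<in>wb_series \<kappa>. \<forall>g\<in>wb_series \<kappa>. f \<le> g \<longrightarrow> cmp f s \<le> cmp g s) \<and>
        (\<forall>f\<in>positive \<kappa>. cmp (lg f) s = lg (cmp f s))) \<and>
     (\<forall>s\<in>pos_infinite \<kappa>. \<forall>t\<in>pos_infinite \<kappa>. cmp s t \<in> pos_infinite \<kappa>) \<and>
     (\<forall>f\<in>wb_series \<kappa>. \<forall>s\<in>pos_infinite \<kappa>. \<forall>t\<in>pos_infinite \<kappa>. cmp f (cmp s t) = cmp (cmp f s) t) \<and>
     monom x \<in> (pos_infinite \<kappa> :: ('n, 'r) series set) \<and>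
     (\<forall>s\<in>pos_infinite \<kappa>. cmp (monom x) s = s) \<and>
     (\<forall>f\<in>wb_series \<kappa>. cmp f (monom x) = f)"

definition flat_composition ::
  "'k rel \<Rightarrow> ('n::linordered_ab_group_mult, 'r::linordered_field) series_op
    \<Rightarrow> (('n, 'r) series \<Rightarrow> ('n, 'r) series_op) \<Rightarrow> bool" where
  "flat_composition \<kappa> lg cmp \<longleftrightarrow>
     (\<forall>s\<in>pos_infinite \<kappa>. \<forall>m. m \<noteq> 1 \<longrightarrow> (\<forall>n\<in>supp (cmp (monom m) s). \<exists>f w. \<exists>u\<in>supp s.
        flatter lg (monom f) (monom m) \<and> monom w \<preceq> (1 :: ('n, 'r) series) \<and>
        flatter_eq lg (monom w) (monom u) \<and> n = dmon (cmp (monom m) s) * f * w))"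

definition chain_rule ::
  "'k rel \<Rightarrow> ('n::linordered_ab_group_mult, 'r::linordered_field) series_op
    \<Rightarrow> (('n, 'r) series \<Rightarrow> ('n, 'r) series_op) \<Rightarrow> bool" where
  "chain_rule \<kappa> D cmp \<longleftrightarrow>
     (\<forall>f\<in>wb_series \<kappa>. \<forall>s\<in>pos_infinite \<kappa>. D (cmp f s) = D s * cmp (D f) s)"

definition taylor_expansions ::
  "'k rel \<Rightarrow> ('n::linordered_ab_group_mult, 'r::linordered_field) series_op
    \<Rightarrow> (('n, 'r) series \<Rightarrow> ('n, 'r) series_op) \<Rightarrow> bool" where
  "taylor_expansions \<kappa> D cmp \<longleftrightarrow>
     (\<forall>f\<in>wb_series \<kappa>. \<forall>s\<in>pos_infinite \<kappa>. \<forall>\<delta>\<in>wb_series \<kappa>.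
        \<delta> \<prec> s \<and> (\<forall>m\<in>supp f. cmp (D (monom m)) s * \<delta> \<prec> cmp (monom m) s) \<longrightarrow>
        summable_family \<kappa> (supp f \<times> UNIV) (\<lambda>(m, k). cmp ((D ^^ k) (monom m)) s * \<delta> ^ k) \<and>
        sums_to \<kappa> UNIV (\<lambda>k. scale (1 / fact k) (cmp ((D ^^ k) f) s * \<delta> ^ k)) (cmp f (s + \<delta>)) \<and>
        sums_to \<kappa> (supp f \<times> UNIV)
          (\<lambda>(m, k). scale (coeff f m / fact k) (cmp ((D ^^ k) (monom m)) s * \<delta> ^ k))
          (cmp f (s + \<delta>)) \<and>
        (\<forall>k. cmp ((D ^^ k) f) s * \<delta> ^ k \<noteq> 0 \<longrightarrow>
           cmp ((D ^^ Suc k) f) s * \<delta> ^ Suc k \<prec> cmp ((D ^^ k) f) s * \<delta> ^ k))"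

definition comp_monoid ::
  "'k rel \<Rightarrow> (('n::linordered_ab_group_mult, 'r::linordered_field) series \<Rightarrow> ('n, 'r) series_op)
    \<Rightarrow> 'n \<Rightarrow> ('n, 'r) series monoid" where
  "comp_monoid \<kappa> cmp x = \<lparr>carrier = pos_infinite \<kappa>, mult = cmp, one = monom x\<rparr>"

definition monotone_composition ::
  "'k rel \<Rightarrow> ('n::linordered_ab_group_mult, 'r::linordered_field) series_op
    \<Rightarrow> (('n, 'r) series \<Rightarrow> ('n, 'r) series_op) \<Rightarrow> bool" where
  "monotone_composition \<kappa> D cmp \<longleftrightarrow>
     (\<forall>f\<in>wb_series \<kappa> - range const.
        (0 < D f \<longrightarrow> monotone_on (pos_infinite \<kappa>) (<) (<) (cmp f)) \<and>
        (D f < 0 \<longrightarrow> monotone_on (pos_infinite \<kappa>) (<) (>) (cmp f)))"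


section \<open>Conjugacy and centralisers\<close>

definition conjugate :: "('a, 'b) monoid_scheme \<Rightarrow> 'a \<Rightarrow> 'a \<Rightarrow> bool" where
  "conjugate G f g \<longleftrightarrow> (\<exists>h\<in>carrier G. h \<otimes>\<^bsub>G\<^esub> f = g \<otimes>\<^bsub>G\<^esub> h)"

definition centraliser :: "('a, 'b) monoid_scheme \<Rightarrow> 'a \<Rightarrow> 'a set" where
  "centraliser G f = {h \<in> carrier G. h \<otimes>\<^bsub>G\<^esub> f = f \<otimes>\<^bsub>G\<^esub> h}"

end

theory Submission
  imports Defs
begin

text \<open>
  Any two elements above the identity \<open>x\<close> are conjugate, and conjugation by a fixed element is an
  order isomorphism because the group is bi-ordered. Since \<open>f\<close> and its inverse have the same
  centraliser, and one of the two lies above \<open>x\<close>, it suffices to describe the centraliser of the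
  single element \<open>x + 1\<close>.

  Let \<open>h\<close> commute with \<open>x + 1\<close>, that is, \<open>h \<circ> (x + 1) = h + 1\<close>. By the chain rule, the derivative
  \<open>g = h'\<close> satisfies \<open>g \<circ> (x + 1) = g\<close>. If \<open>g\<close> were not a constant, then \<open>s \<mapsto> g \<circ> s\<close> would be
  strictly monotone, whereas it takes the same value at \<open>x\<close> and at \<open>x + 1\<close>
  (lemma \<open>translation_invariant_imp_const\<close>). So \<open>h'\<close> is a constant \<open>r\<close> and \<open>h = r x + c\<close> with \<open>c\<close> a
  constant; inserting this into \<open>h \<circ> (x + 1) = h + 1\<close> yields \<open>r = 1\<close>. Hence the centraliser of
  \<open>x + 1\<close> consists of the translations \<open>x + c\<close> (lemma \<open>centraliser_translation\<close>), and
  \<open>x + c \<mapsto> c\<close> is the required isomorphism.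
\<close>

section \<open>Centralisers in bi-ordered groups\<close>

lemma ordered_group_iso_trans:
  assumes "ordered_group_iso G H \<phi>" "ordered_group_iso H K \<psi>"
  shows "ordered_group_iso G K (\<psi> \<circ> \<phi>)"
proof -
  have iso: "\<phi> \<in> iso G H" "\<psi> \<in> iso H K" and grp: "group G" "group K"
    using assms by (auto simp: ordered_group_iso_def)
  have "\<phi> a \<in> carrier H" if "a \<in> carrier G" for a
    using iso(1) that by (auto simp: iso_def hom_def)
  then show ?thesis
    using assms iso_set_trans[OF iso] grp by (simp add: ordered_group_iso_def)
qed

context group
begin

lemma subgroup_centraliser:
  assumes f: "f \<in> carrier G"
  shows "subgroup (centraliser G f) G"
proof (rule subgroupI)
  show "centraliser G f \<subseteq> carrier G"
    by (auto simp: centraliser_def)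
  show "centraliser G f \<noteq> {}"
    using f by (auto simp: centraliser_def)
next
  fix a assume "a \<in> centraliser G f"
  then have a: "a \<in> carrier G" "a \<otimes> f = f \<otimes> a"
    by (auto simp: centraliser_def)
  have "inv a \<otimes> f = inv a \<otimes> (f \<otimes> a) \<otimes> inv a"
    using a(1) f by (simp add: m_assoc)
  also have "\<dots> = f \<otimes> inv a"
    using a f by (simp add: a(2)[symmetric] m_assoc[symmetric])
  finally show "inv a \<in> centraliser G f"
    using a(1) by (simp add: centraliser_def)
next
  fix a b assume "a \<in> centraliser G f" "b \<in> centraliser G f"
  then have a: "a \<in> carrier G" "a \<otimes> f = f \<otimes> a" and b: "b \<in> carrier G" "b \<otimes> f = f \<otimes> b"
    by (auto simp: centraliser_def)
  have "a \<otimes> b \<otimes> f = a \<otimes> f \<otimes> b"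
    using a(1) b f by (simp add: m_assoc)
  then show "a \<otimes> b \<in> centraliser G f"
    using a b(1) f by (simp add: centraliser_def m_assoc)
qed

lemma centraliser_inv_subset:
  assumes f: "f \<in> carrier G"
  shows "centraliser G f \<subseteq> centraliser G (inv f)"
proof
  fix a assume "a \<in> centraliser G f"
  then have a: "a \<in> carrier G" and "f \<in> centraliser G a"
    using f by (auto simp: centraliser_def)
  then have "inv f \<in> centraliser G a"
    using subgroup.m_inv_closed[OF subgroup_centraliser] by blast
  then show "a \<in> centraliser G (inv f)"
    using a by (simp add: centraliser_def)
qed

lemma centraliser_inv:
  assumes "f \<in> carrier G"
  shows "centraliser G (inv f) = centraliser G f"
  using centraliser_inv_subset[of f] centraliser_inv_subset[of "inv f"] assms by auto

lemma inv_mult_cancel: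
  assumes "h \<in> carrier G" "y \<in> carrier G"
  shows "inv h \<otimes> (h \<otimes> y) = y" and "h \<otimes> (inv h \<otimes> y) = y"
  using assms by (simp_all add: m_assoc[symmetric])

lemma inv_conjugator:
  assumes h: "h \<in> carrier G" and f: "f \<in> carrier G" and g: "g \<in> carrier G"
    and hf: "h \<otimes> f = g \<otimes> h"
  shows "inv h \<otimes> g = f \<otimes> inv h"
proof -
  have "inv h \<otimes> g = inv h \<otimes> (g \<otimes> h) \<otimes> inv h"
    using h g by (simp add: m_assoc)
  also have "\<dots> = f \<otimes> inv h"
    using h f by (simp add: hf[symmetric] m_assoc[symmetric])
  finally show ?thesis .
qed

lemma conj_mem_centraliser:
  assumes h: "h \<in> carrier G" and f: "f \<in> carrier G" and g: "g \<in> carrier G"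
    and hf: "h \<otimes> f = g \<otimes> h" and a: "a \<in> centraliser G f"
  shows "h \<otimes> a \<otimes> inv h \<in> centraliser G g"
proof -
  have ac: "a \<in> carrier G" "a \<otimes> f = f \<otimes> a"
    using a by (auto simp: centraliser_def)
  note inv_hg = inv_conjugator[OF h f g hf]
  have "h \<otimes> a \<otimes> inv h \<otimes> g = h \<otimes> (a \<otimes> f) \<otimes> inv h"
    using h f g ac(1) inv_hg by (simp add: m_assoc)
  also have "\<dots> = (h \<otimes> f) \<otimes> a \<otimes> inv h"
    using h f ac by (simp add: m_assoc)
  also have "\<dots> = g \<otimes> (h \<otimes> a \<otimes> inv h)"
    using h g ac(1) hf by (simp add: m_assoc)
  finally show ?thesis
    using h ac(1) by (simp add: centraliser_def)
qed

lemma conjugate_centralisers_iso: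
  assumes h: "h \<in> carrier G" and f: "f \<in> carrier G" and g: "g \<in> carrier G"
    and hf: "h \<otimes> f = g \<otimes> h"
  shows "(\<lambda>a. h \<otimes> a \<otimes> inv h) \<in>
    iso (G\<lparr>carrier := centraliser G f\<rparr>) (G\<lparr>carrier := centraliser G g\<rparr>)"
proof -
  let ?c = "\<lambda>a. h \<otimes> a \<otimes> inv h"
  have carr: "a \<in> carrier G" if "a \<in> centraliser G f'" for a f'
    using that by (simp add: centraliser_def)
  note inv_hg = inv_conjugator[OF h f g hf]
  have "bij_betw ?c (centraliser G f) (centraliser G g)"
  proof (rule bij_betw_byWitness[where f' = "\<lambda>b. inv h \<otimes> b \<otimes> h"])
    show "\<forall>a\<in>centraliser G f. inv h \<otimes> (?c a) \<otimes> h = a"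
    proof
      fix a assume "a \<in> centraliser G f"
      then show "inv h \<otimes> (?c a) \<otimes> h = a"
        using h carr[of a] by (simp add: m_assoc inv_mult_cancel)
    qed
    show "\<forall>b\<in>centraliser G g. ?c (inv h \<otimes> b \<otimes> h) = b"
    proof
      fix b assume "b \<in> centraliser G g"
      then show "?c (inv h \<otimes> b \<otimes> h) = b"
        using h carr[of b] by (simp add: m_assoc inv_mult_cancel)
    qed
    show "?c ` centraliser G f \<subseteq> centraliser G g"
      using conj_mem_centraliser[OF h f g hf] by blast
    show "(\<lambda>b. inv h \<otimes> b \<otimes> h) ` centraliser G g \<subseteq> centraliser G f"
      using conj_mem_centraliser[OF inv_closed[OF h] g f inv_hg] h by auto
  qed
  moreover have "?c (a \<otimes> b) = ?c a \<otimes> ?c b" if "a \<in> carrier G" "b \<in> carrier G" for a b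
  proof -
    have "?c a \<otimes> ?c b = h \<otimes> a \<otimes> (inv h \<otimes> h) \<otimes> b \<otimes> inv h"
      using h that by (simp add: m_assoc inv_mult_cancel)
    then show ?thesis
      using h that by (simp add: m_assoc)
  qed
  ultimately show ?thesis
    using conj_mem_centraliser[OF h f g hf] by (auto simp: iso_def hom_def carr)
qed

end

lemma conjugate_centralisers_ordered_iso:
  fixes G :: "('a::ord, 'b) monoid_scheme" (structure)
  assumes G: "group G"
    and l_mono: "\<And>a b c. \<lbrakk>a \<in> carrier G; b \<in> carrier G; c \<in> carrier G; a < b\<rbrakk> \<Longrightarrow> c \<otimes> a < c \<otimes> b"
    and r_mono: "\<And>a b c. \<lbrakk>a \<in> carrier G; b \<in> carrier G; c \<in> carrier G; a < b\<rbrakk> \<Longrightarrow> a \<otimes> c < b \<otimes> c"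
    and f: "f \<in> carrier G" and g: "g \<in> carrier G" and conj: "conjugate G f g"
  shows "\<exists>\<phi>. ordered_group_iso
    \<lparr>carrier = centraliser G f, mult = mult G, one = \<one>\<rparr>
    \<lparr>carrier = centraliser G g, mult = mult G, one = \<one>\<rparr> \<phi>"
proof -
  interpret group G by (rule G)
  obtain h where h: "h \<in> carrier G" and hf: "h \<otimes> f = g \<otimes> h"
    using conj by (auto simp: conjugate_def)
  let ?c = "\<lambda>a. h \<otimes> a \<otimes> inv h"
  have grp: "group \<lparr>carrier = centraliser G f, mult = mult G, one = \<one>\<rparr>"
    if "f \<in> carrier G" for f
  proof -
    interpret C: subgroup "centraliser G f" G
      by (rule subgroup_centraliser[OF that])
    show ?thesis
    proof (rule groupI, simp_all add: m_assoc)
      show "\<exists>b\<in>centraliser G f. b \<otimes> a = \<one>" if "a \<in> centraliser G f" for a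
        using that by (intro bexI[of _ "inv a"]) simp_all
    qed
  qed
  have c_closed: "?c a \<in> carrier G" if "a \<in> carrier G" for a
    using h that by simp
  have "?c a < ?c b \<longleftrightarrow> a < b" if ab: "a \<in> carrier G" "b \<in> carrier G" for a b
  proof
    assume "a < b"
    then have "h \<otimes> a < h \<otimes> b"
      by (rule l_mono[OF ab h])
    then show "?c a < ?c b"
      by (rule r_mono[OF m_closed[OF h ab(1)] m_closed[OF h ab(2)] inv_closed[OF h]])
  next
    assume "?c a < ?c b"
    then have "inv h \<otimes> ?c a < inv h \<otimes> ?c b"
      by (rule l_mono[OF c_closed[OF ab(1)] c_closed[OF ab(2)] inv_closed[OF h]])
    then have "inv h \<otimes> ?c a \<otimes> h < inv h \<otimes> ?c b \<otimes> h"
      by (rule r_mono[OF m_closed[OF inv_closed[OF h] c_closed[OF ab(1)]]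
            m_closed[OF inv_closed[OF h] c_closed[OF ab(2)]] h])
    moreover have "inv h \<otimes> ?c d \<otimes> h = d" if "d \<in> carrier G" for d
      using h that by (simp add: m_assoc inv_mult_cancel)
    ultimately show "a < b"
      using ab by simp
  qed
  moreover have "?c \<in> iso \<lparr>carrier = centraliser G f, mult = mult G, one = \<one>\<rparr>
      \<lparr>carrier = centraliser G g, mult = mult G, one = \<one>\<rparr>"
    using conjugate_centralisers_iso[OF h f g hf] by (simp add: iso_def hom_def)
  ultimately have "ordered_group_iso
    \<lparr>carrier = centraliser G f, mult = mult G, one = \<one>\<rparr>
    \<lparr>carrier = centraliser G g, mult = mult G, one = \<one>\<rparr> ?c"
    using grp f g by (simp add: ordered_group_iso_def centraliser_def)
  then show ?thesis by (intro exI)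
qed


section \<open>Well-based series\<close>

lemma series_eqI: "(\<And>n. coeff s n = coeff t n) \<Longrightarrow> s = t"
  by (cases s, cases t) auto

lemma coeff_simps [simp]:
  fixes s t :: "('n::linordered_ab_group_mult, 'r::linordered_field) series"
  shows "coeff (s + t) n = coeff s n + coeff t n"
    and "coeff (s - t) n = coeff s n - coeff t n"
    and "coeff (- s) n = - coeff s n"
    and "coeff (0 :: ('n, 'r) series) n = 0"
    and "coeff (1 :: ('n, 'r) series) n = (if n = 1 then 1 else 0)"
    and "coeff (scale r s) n = r * coeff s n"
    and "coeff (const r :: ('n, 'r) series) n = (if n = 1 then r else 0)"
    and "coeff (monom m :: ('n, 'r) series) n = (if n = m then 1 else 0)"
  by (simp_all add: plus_series_def minus_series_def uminus_series_def zero_series_def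
      one_series_def scale_def const_def monom_def)

lemma one_mult_series:
  fixes s :: "('n::linordered_ab_group_mult, 'r::linordered_field) series"
  shows "1 * s = s"
proof (rule series_eqI)
  fix n
  have "{(a, b). a \<in> supp (1 :: ('n, 'r) series) \<and> b \<in> supp s \<and> a * b = n}
      = (if coeff s n = 0 then {} else {(1, n)})"
    by (auto simp: supp_def split: if_splits)
  then show "coeff (1 * s) n = coeff s n"
    by (simp add: times_series_def)
qed

lemma dmon_in_supp:
  fixes s :: "('n::linordered_ab_group_mult, 'r::linordered_field) series"
  assumes "s \<in> wb_series \<kappa>" "s \<noteq> 0"
  shows "dmon s \<in> supp s"
proof -
  have "supp s \<noteq> {}"
    using assms(2) by (auto simp: supp_def intro: series_eqI)
  then obtain m where m: "m \<in> supp s" "\<forall>y. y > m \<longrightarrow> y \<notin> supp s"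
    using assms(1) unfolding wb_series_def wb_set_def wfp_on_iff_ex_minimal by blast
  then have "dmon s = m"
    unfolding dmon_def by (intro Greatest_equality) (auto simp: not_less[symmetric])
  with m show ?thesis by simp
qed

lemma wb_set_finite:
  assumes "regular_uncountable \<kappa>" "finite S"
  shows "wb_set \<kappa> (S :: 'n::linorder set)"
proof -
  have "|S| <o natLeq"
    using assms(2) finite_iff_ordLess_natLeq by blast
  then have "|S| <o \<kappa>"
    using assms(1) ordLess_transitive by (auto simp: regular_uncountable_def)
  moreover have "wfp_on S (>)"
    unfolding wfp_on_iff_ex_minimal
  proof (intro allI impI)
    fix B assume B: "B \<subseteq> S" "B \<noteq> {}"
    then have "finite B"
      using assms(2) finite_subset by blast
    then show "\<exists>z\<in>B. \<forall>y. y > z \<longrightarrow> y \<notin> B"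
      using B(2) Max_in Max_ge by (metis leD)
  qed
  ultimately show ?thesis by (simp add: wb_set_def)
qed

lemma wb_set_Un:
  assumes \<kappa>: "regular_uncountable \<kappa>" and S: "wb_set \<kappa> S" and T: "wb_set \<kappa> T"
  shows "wb_set \<kappa> (S \<union> T :: 'n::linorder set)"
proof -
  have card: "Card_order \<kappa>" and "natLeq <o \<kappa>"
    using \<kappa> by (auto simp: regular_uncountable_def)
  have "infinite (Field \<kappa>)"
  proof
    assume "finite (Field \<kappa>)"
    then have "|Field \<kappa>| <o natLeq"
      using finite_iff_ordLess_natLeq by blast
    then have "\<kappa> <o natLeq"
      using card_of_Field_ordIso[OF card] ordIso_ordLess_trans ordIso_symmetric by blast
    then show False
      using \<open>natLeq <o \<kappa>\<close> ordLess_transitive ordLess_irreflexive by blast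
  qed
  then have "|S \<union> T| <o \<kappa>"
    using card_of_Un_ordLess_infinite_Field card S T by (auto simp: wb_set_def)
  moreover have "wfp_on (S \<union> T) (>)"
    unfolding wfp_on_iff_ex_minimal
  proof (intro allI impI)
    have max: "\<exists>z\<in>B. \<forall>y\<in>B. y \<le> z" if "wb_set \<kappa> A" "B \<subseteq> A" "B \<noteq> {}" for A B :: "'n set"
      using that unfolding wb_set_def wfp_on_iff_ex_minimal by (meson not_less)
    fix B assume B: "B \<subseteq> S \<union> T" "B \<noteq> {}"
    have "\<exists>z\<in>B. \<forall>y\<in>B. y \<le> z"
    proof (cases "B \<inter> S = {} \<or> B \<inter> T = {}")
      case True
      then have "B \<subseteq> S \<or> B \<subseteq> T"
        using B(1) by blast
      then show ?thesis
        using max[OF S _ B(2)] max[OF T _ B(2)] by blast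
    next
      case False
      then obtain u v where u: "u \<in> B \<inter> S" "\<forall>y\<in>B \<inter> S. y \<le> u"
        and v: "v \<in> B \<inter> T" "\<forall>y\<in>B \<inter> T. y \<le> v"
        using max[OF S, of "B \<inter> S"] max[OF T, of "B \<inter> T"] by auto
      have "\<forall>y\<in>B. y \<le> max u v"
        using B(1) u(2) v(2) by (auto simp: le_max_iff_disj)
      moreover have "max u v \<in> B"
        using u v by (simp add: max_def)
      ultimately show ?thesis by blast
    qed
    then show "\<exists>z\<in>B. \<forall>y. y > z \<longrightarrow> y \<notin> B"
      by (metis leD)
  qed
  ultimately show ?thesis by (simp add: wb_set_def)
qed

lemma wb_set_subset:
  assumes "wb_set \<kappa> T" "S \<subseteq> T"
  shows "wb_set \<kappa> S"
proof -
  have "|S| <o \<kappa>"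
    using assms card_of_mono1 ordLeq_ordLess_trans unfolding wb_set_def by blast
  moreover have "wfp_on S (>)"
    using assms unfolding wb_set_def wfp_on_iff_ex_minimal by (meson subset_trans)
  ultimately show ?thesis by (simp add: wb_set_def)
qed

lemma wb_series_finite_supp:
  assumes "regular_uncountable \<kappa>" "finite (supp s)"
  shows "s \<in> wb_series \<kappa>"
  using wb_set_finite[OF assms] by (simp add: wb_series_def)

lemma
  fixes r :: "'r::linordered_field"
  assumes "regular_uncountable \<kappa>"
  shows const_wb [simp]: "(const r :: ('n::linordered_ab_group_mult, 'r) series) \<in> wb_series \<kappa>"
    and monom_wb: "(monom m :: ('n, 'r) series) \<in> wb_series \<kappa>"
    and scale_monom_wb: "scale r (monom m :: ('n, 'r) series) \<in> wb_series \<kappa>"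
proof -
  have "supp (const r :: ('n, 'r) series) \<subseteq> {1}" "supp (monom m :: ('n, 'r) series) \<subseteq> {m}"
    "supp (scale r (monom m :: ('n, 'r) series)) \<subseteq> {m}"
    by (auto simp: supp_def split: if_splits)
  then show "(const r :: ('n, 'r) series) \<in> wb_series \<kappa>"
    "(monom m :: ('n, 'r) series) \<in> wb_series \<kappa>"
    "scale r (monom m :: ('n, 'r) series) \<in> wb_series \<kappa>"
    using wb_series_finite_supp[OF assms] finite_subset by blast+
qed

lemma add_wb:
  fixes s t :: "('n::linordered_ab_group_mult, 'r::linordered_field) series"
  assumes "regular_uncountable \<kappa>" "s \<in> wb_series \<kappa>" "t \<in> wb_series \<kappa>"
  shows "s + t \<in> wb_series \<kappa>"
proof -
  have "supp (s + t) \<subseteq> supp s \<union> supp t"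
    by (auto simp: supp_def)
  then show ?thesis
    using wb_set_subset wb_set_Un assms unfolding wb_series_def by blast
qed

lemma less_irrefl_series:
  fixes s :: "('n::linordered_ab_group_mult, 'r::linordered_field) series"
  shows "\<not> s < s"
proof -
  have "s - s = 0" by (rule series_eqI) simp
  then show ?thesis by (simp add: less_series_def)
qed

lemma dmon_minus:
  fixes s t :: "('n::linordered_ab_group_mult, 'r::linordered_field) series"
  shows "dmon (s - t) = dmon (t - s)"
proof -
  have "supp (s - t) = supp (t - s)" by (auto simp: supp_def)
  then show ?thesis by (simp add: dmon_def)
qed

lemma less_linear_series:
  fixes s t :: "('n::linordered_ab_group_mult, 'r::linordered_field) series"
  assumes "regular_uncountable \<kappa>" "s \<in> wb_series \<kappa>" "t \<in> wb_series \<kappa>" "s \<noteq> t"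
  shows "s < t \<or> t < s"
proof -
  have nz: "t - s \<noteq> 0" "s - t \<noteq> 0"
    using assms(4) series_eqI by (metis coeff_simps(2,4) right_minus_eq)+
  have "supp (t - s) \<subseteq> supp t \<union> supp s"
    by (auto simp: supp_def)
  then have "t - s \<in> wb_series \<kappa>"
    using wb_set_subset wb_set_Un assms(1-3) unfolding wb_series_def by blast
  then have "coeff (t - s) (dmon (t - s)) \<noteq> 0"
    using dmon_in_supp[of "t - s" \<kappa>] nz(1) unfolding supp_def by blast
  then show ?thesis
    using nz dmon_minus[of s t] by (auto simp: less_series_def)
qed

lemma const_less_iff:
  "(const r :: ('n::linordered_ab_group_mult, 'r::linordered_field) series) < const s \<longleftrightarrow> r < s"
proof -
  have diff: "const s - const r = (const (s - r) :: ('n, 'r) series)"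
    by (rule series_eqI) simp
  show ?thesis
  proof (cases "s = r")
    case True
    then show ?thesis by (simp add: less_irrefl_series)
  next
    case False
    have "dmon (const (s - r) :: ('n, 'r) series) = 1"
      unfolding dmon_def using False
      by (intro Greatest_equality) (auto simp: supp_def split: if_splits)
    moreover have "(const (s - r) :: ('n, 'r) series) \<noteq> 0"
    proof
      assume "(const (s - r) :: ('n, 'r) series) = 0"
      then have "coeff (const (s - r) :: ('n, 'r) series) 1 = 0"
        by (simp del: coeff_simps(7))
      then show False
        using False by simp
    qed
    ultimately show ?thesis
      unfolding less_series_def diff by simp
  qed
qed

lemma add_left_less_iff_series:
  fixes s t u :: "('n::linordered_ab_group_mult, 'r::linordered_field) series"
  shows "u + s < u + t \<longleftrightarrow> s < t"
proof -
  have "(u + t) - (u + s) = t - s" by (rule series_eqI) simp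
  then show ?thesis by (simp add: less_series_def)
qed

lemma less_add_one_series:
  fixes s :: "('n::linordered_ab_group_mult, 'r::linordered_field) series"
  shows "s < s + 1"
proof -
  have "s + const 0 < s + const 1"
    by (simp add: add_left_less_iff_series const_less_iff)
  moreover have "s + const 0 = s"
    by (rule series_eqI) simp
  ultimately show ?thesis by (simp add: one_series_def)
qed

lemma add_const_pos_infinite:
  fixes s :: "('n::linordered_ab_group_mult, 'r::linordered_field) series"
  assumes "regular_uncountable \<kappa>" "s \<in> pos_infinite \<kappa>"
  shows "s + const c \<in> pos_infinite \<kappa>"
proof -
  have "const r < s + const c" for r
  proof -
    have "s + const c - const r = s - const (r - c)"
      by (rule series_eqI) simp
    moreover have "const (r - c) < s"
      using assms(2) by (simp add: pos_infinite_def)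
    ultimately show ?thesis
      by (simp add: less_series_def)
  qed
  then show ?thesis
    using assms add_wb const_wb unfolding pos_infinite_def by blast
qed


section \<open>The group of positive infinite series\<close>

lemma
  assumes "transserial_composition \<kappa> lg cmp x" "s \<in> pos_infinite \<kappa>"
  shows comp_add: "f \<in> wb_series \<kappa> \<Longrightarrow> g \<in> wb_series \<kappa> \<Longrightarrow> cmp (f + g) s = cmp f s + cmp g s"
    and comp_scale: "f \<in> wb_series \<kappa> \<Longrightarrow> cmp (scale r f) s = scale r (cmp f s)"
    and comp_one: "cmp 1 s = 1"
    and comp_identity: "cmp (monom x) s = s"
    and comp_mono: "f \<in> wb_series \<kappa> \<Longrightarrow> g \<in> wb_series \<kappa> \<Longrightarrow> f \<le> g \<Longrightarrow> cmp f s \<le> cmp g s"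
  using assms by (auto simp: transserial_composition_def strongly_linear_def)

lemma comp_const:
  fixes cmp :: "('n::linordered_ab_group_mult, 'r::linordered_field) series \<Rightarrow> ('n, 'r) series_op"
  assumes \<kappa>: "regular_uncountable \<kappa>"
    and comp: "transserial_composition \<kappa> lg cmp x" "s \<in> pos_infinite \<kappa>"
  shows "cmp (const r) s = const r"
proof -
  have sc: "const r = scale r (1 :: ('n, 'r) series)"
    by (rule series_eqI) simp
  have "(1 :: ('n, 'r) series) \<in> wb_series \<kappa>"
    using \<kappa> by (simp add: one_series_def)
  then show ?thesis
    by (simp add: sc comp_scale[OF comp] comp_one[OF comp])
qed

lemma comp_left_strict_mono:
  fixes a b :: "('n::linordered_ab_group_mult, 'r::linordered_field) series"
  assumes "H_field \<kappa> D" "monotone_composition \<kappa> D cmp"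
    and "a \<in> pos_infinite \<kappa>" "b \<in> pos_infinite \<kappa>" "h \<in> pos_infinite \<kappa>" "a < b"
  shows "cmp h a < cmp h b"
proof -
  have "h \<notin> range const"
    using assms(5) less_irrefl_series by (auto simp: pos_infinite_def)
  moreover have "0 < D h" "h \<in> wb_series \<kappa>"
    using assms(1,5) by (auto simp: H_field_def pos_infinite_def)
  ultimately have "monotone_on (pos_infinite \<kappa>) (<) (<) (cmp h)"
    using assms(2) by (simp add: monotone_composition_def)
  then show ?thesis
    using assms(3,4,6) by (simp add: monotone_on_def)
qed

lemma comp_right_strict_mono:
  fixes a b :: "('n::linordered_ab_group_mult, 'r::linordered_field) series"
  assumes comp: "transserial_composition \<kappa> lg cmp x" and "group (comp_monoid \<kappa> cmp x)"
    and a: "a \<in> pos_infinite \<kappa>" and b: "b \<in> pos_infinite \<kappa>" and s: "s \<in> pos_infinite \<kappa>"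
    and "a < b"
  shows "cmp a s < cmp b s"
proof -
  interpret group "comp_monoid \<kappa> cmp x" by fact
  have "cmp a s \<le> cmp b s"
    using comp_mono[OF comp s] a b \<open>a < b\<close> by (simp add: pos_infinite_def less_eq_series_def)
  moreover have "a \<noteq> b"
    using \<open>a < b\<close> by (auto simp: less_irrefl_series)
  then have "cmp a s \<noteq> cmp b s"
    using right_cancel[of s a b] a b s by (simp add: comp_monoid_def)
  ultimately show ?thesis
    by (simp add: less_eq_series_def)
qed

text \<open>
  A nonconstant \<open>g\<close> has a nonzero derivative, so \<open>s \<mapsto> g \<circ> s\<close> is strictly monotone and separates \<open>x\<close>
  from \<open>x + 1\<close>.
\<close>

lemma translation_invariant_imp_const:
  fixes g :: "('n::linordered_ab_group_mult, 'r::linordered_field) series"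
  assumes \<kappa>: "regular_uncountable \<kappa>" and D: "strongly_linear \<kappa> D" and H: "H_field \<kappa> D"
    and mono: "monotone_composition \<kappa> D cmp" and comp: "transserial_composition \<kappa> lg cmp x"
    and g: "g \<in> wb_series \<kappa>" and inv: "cmp g (monom x + 1) = g"
  shows "g \<in> range const"
proof (rule ccontr)
  assume nc: "g \<notin> range const"
  have x: "(monom x :: ('n, 'r) series) \<in> pos_infinite \<kappa>" and gx: "cmp g (monom x) = g"
    using comp g by (auto simp: transserial_composition_def)
  have x1: "(monom x :: ('n, 'r) series) + 1 \<in> pos_infinite \<kappa>"
    using add_const_pos_infinite[OF \<kappa> x] by (simp add: one_series_def)
  have "D g \<noteq> 0" "D g \<in> wb_series \<kappa>"
    using nc H D g by (auto simp: H_field_def strongly_linear_def)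
  moreover have "0 \<in> wb_series \<kappa>"
    by (rule wb_series_finite_supp[OF \<kappa>]) (simp add: supp_def)
  ultimately have "0 < D g \<or> D g < 0"
    using less_linear_series[OF \<kappa>] by metis
  moreover have "monotone_on (pos_infinite \<kappa>) (<) (<) (cmp g)" if "0 < D g"
    using mono nc g that by (simp add: monotone_composition_def)
  moreover have "monotone_on (pos_infinite \<kappa>) (<) (>) (cmp g)" if "D g < 0"
    using mono nc g that by (simp add: monotone_composition_def)
  ultimately have "cmp g (monom x) < cmp g (monom x + 1) \<or> cmp g (monom x + 1) < cmp g (monom x)"
    using x x1 less_add_one_series unfolding monotone_on_def by blast
  then show False
    by (simp add: gx inv less_irrefl_series)
qed


section \<open>The centraliser of the unit translation\<close>

lemma centraliser_translation:
  fixes cmp :: "('n::linordered_ab_group_mult, 'r::linordered_field) series \<Rightarrow> ('n, 'r) series_op"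
  assumes \<kappa>: "regular_uncountable \<kappa>"
    and der: "surjective_flat_transserial_derivation \<kappa> lg D x"
    and H: "H_field \<kappa> D"
    and comp: "transserial_composition \<kappa> lg cmp x"
    and chain: "chain_rule \<kappa> D cmp"
    and mono: "monotone_composition \<kappa> D cmp"
  shows "centraliser (comp_monoid \<kappa> cmp x) (monom x + 1) =
    range (\<lambda>c. (monom x :: ('n, 'r) series) + const c)"
proof -
  have D: "strongly_linear \<kappa> D" and "x \<noteq> 1" and Dx: "D (monom x) = 1"
    using der by (auto simp: surjective_flat_transserial_derivation_def transserial_derivation_def)
  have D_add: "D (s + t) = D s + D t" if "s \<in> wb_series \<kappa>" "t \<in> wb_series \<kappa>" for s t
    using D that by (simp add: strongly_linear_def)
  have D_scale: "D (scale r s) = scale r (D s)" if "s \<in> wb_series \<kappa>" for r s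
    using D that by (simp add: strongly_linear_def)
  have D_const: "D (const r) = 0" for r
    using H by (auto simp: H_field_def)
  have add_0: "s + 0 = s" for s :: "('n, 'r) series"
    by (rule series_eqI) simp
  have x: "(monom x :: ('n, 'r) series) \<in> pos_infinite \<kappa>"
    using comp by (simp add: transserial_composition_def)
  note xw = monom_wb[OF \<kappa>, where m = x] and cw = const_wb[OF \<kappa>]
  have trans: "(monom x :: ('n, 'r) series) + const c \<in> pos_infinite \<kappa>" for c
    using add_const_pos_infinite[OF \<kappa> x] .
  have comp_trans: "cmp (monom x + const c) s = s + const c" if "s \<in> pos_infinite \<kappa>" for c s
    using comp_add[OF comp that xw cw] comp_identity[OF comp that] comp_const[OF \<kappa> comp that]
    by simp
  note comp_trans1 = comp_trans[where c = 1, folded one_series_def]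
  note trans1 = trans[where c = 1, folded one_series_def]
  show ?thesis
  proof (intro equalityI subsetI)
    fix h assume "h \<in> centraliser (comp_monoid \<kappa> cmp x) (monom x + 1)"
    then have h: "h \<in> pos_infinite \<kappa>" and "cmp h (monom x + 1) = cmp (monom x + 1) h"
      by (auto simp: centraliser_def comp_monoid_def)
    then have h1: "cmp h (monom x + 1) = h + 1"
      by (simp add: comp_trans1)
    have hw: "h \<in> wb_series \<kappa>"
      using h by (simp add: pos_infinite_def)
    then have Dhw: "D h \<in> wb_series \<kappa>"
      using D by (simp add: strongly_linear_def)
    have "D (h + 1) = D h"
      using D_add[OF hw cw] by (simp add: one_series_def D_const add_0)
    moreover have "D (monom x + 1) = 1"
      using D_add[OF xw cw] Dx by (simp add: one_series_def D_const add_0)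
    moreover have "D (cmp h (monom x + 1)) = D (monom x + 1) * cmp (D h) (monom x + 1)"
      using chain hw trans1 by (simp add: chain_rule_def)
    ultimately have "cmp (D h) (monom x + 1) = D h"
      by (simp add: h1 one_mult_series)
    then obtain r where r: "D h = const r"
      using translation_invariant_imp_const[OF \<kappa> D H mono comp Dhw] by blast
    have sw: "scale r (monom x) \<in> wb_series \<kappa>" for r :: 'r
      using scale_monom_wb[OF \<kappa>] .
    have "D (h + scale (- r) (monom x)) = const r + scale (- r) 1"
      using D_add[OF hw sw] D_scale[OF xw] r Dx by simp
    also have "\<dots> = 0"
      by (rule series_eqI) simp
    finally have "h + scale (- r) (monom x) \<in> range const"
      using H add_wb[OF \<kappa> hw sw] by (auto simp: H_field_def)
    then obtain c where c: "h + scale (- r) (monom x) = const c"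
      by blast
    have h_eq: "h = scale r (monom x) + const c"
      unfolding c[symmetric] by (rule series_eqI) simp
    have "cmp h (monom x + 1) = scale r (monom x + 1) + const c"
      unfolding h_eq
      by (simp add: comp_add[OF comp trans1 sw cw] comp_scale[OF comp trans1 xw]
          comp_identity[OF comp trans1] comp_const[OF \<kappa> comp trans1])
    \<comment> \<open>At the monomial \<open>1\<close>, which differs from \<open>x\<close>, this compares \<open>r + c\<close> with \<open>c + 1\<close>.\<close>
    then have "coeff (scale r (monom x + 1) + const c) 1 = coeff (h + 1) 1"
      using h1 by simp
    then have "r = 1"
      using \<open>x \<noteq> 1\<close> by (simp add: h_eq)
    then have "h = monom x + const c"
      unfolding h_eq by (intro series_eqI) simp
    then show "h \<in> range (\<lambda>c. (monom x :: ('n, 'r) series) + const c)"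
      by blast
  next
    fix h assume "h \<in> range (\<lambda>c. (monom x :: ('n, 'r) series) + const c)"
    then obtain c where h: "h = monom x + const c"
      by blast
    have "monom x + 1 + const c = monom x + const c + 1"
      by (rule series_eqI) simp
    then show "h \<in> centraliser (comp_monoid \<kappa> cmp x) (monom x + 1)"
      using comp_trans[OF trans1, of c] comp_trans1[OF trans[of c]] trans[of c]
      by (simp add: h centraliser_def comp_monoid_def)
  qed
qed

text \<open>Since \<open>x \<noteq> 1\<close>, the constant \<open>c\<close> is recovered from \<open>x + c\<close> as the coefficient at the monomial \<open>1\<close>.\<close>

lemma centraliser_translation_ordered_iso:
  fixes cmp :: "('n::linordered_ab_group_mult, 'r::linordered_field) series \<Rightarrow> ('n, 'r) series_op"
  assumes \<kappa>: "regular_uncountable \<kappa>"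
    and der: "surjective_flat_transserial_derivation \<kappa> lg D x"
    and H: "H_field \<kappa> D"
    and comp: "transserial_composition \<kappa> lg cmp x"
    and chain: "chain_rule \<kappa> D cmp"
    and G: "group (comp_monoid \<kappa> cmp x)"
    and mono: "monotone_composition \<kappa> D cmp"
  shows "ordered_group_iso
    \<lparr>carrier = centraliser (comp_monoid \<kappa> cmp x) (monom x + 1), mult = cmp, one = monom x\<rparr>
    \<lparr>carrier = (UNIV :: 'r set), mult = (+), one = 0\<rparr> (\<lambda>h. coeff h 1)"
proof -
  let ?C = "centraliser (comp_monoid \<kappa> cmp x) (monom x + 1)"
  have C: "?C = range (\<lambda>c. (monom x :: ('n, 'r) series) + const c)"
    by (rule centraliser_translation[OF \<kappa> der H comp chain mono])
  have "x \<noteq> 1"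
    using der by (simp add: surjective_flat_transserial_derivation_def)
  then have coeff: "coeff (monom x + const c :: ('n, 'r) series) 1 = c" for c
    by simp
  have x: "(monom x :: ('n, 'r) series) \<in> pos_infinite \<kappa>"
    using comp by (simp add: transserial_composition_def)
  note trans = add_const_pos_infinite[OF \<kappa> x]
  interpret group "comp_monoid \<kappa> cmp x" by (rule G)
  have "monom x + 1 \<in> carrier (comp_monoid \<kappa> cmp x)"
    using trans[of 1] by (simp add: comp_monoid_def one_series_def)
  from subgroup.subgroup_is_group[OF subgroup_centraliser[OF this] G]
  have grp: "group \<lparr>carrier = ?C, mult = cmp, one = monom x\<rparr>"
    by (simp add: comp_monoid_def)
  have grp_add: "group \<lparr>carrier = (UNIV :: 'r set), mult = (+), one = 0\<rparr>"
    by (rule groupI) (auto simp: add.assoc intro: exI[of _ "- _"])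
  have comp_trans: "cmp (monom x + const c) (monom x + const d) = monom x + const (c + d)" for c d
  proof -
    have "cmp (monom x + const c) (monom x + const d) = monom x + const d + const c"
      using comp_add[OF comp trans monom_wb[OF \<kappa>] const_wb[OF \<kappa>]]
        comp_identity[OF comp trans] comp_const[OF \<kappa> comp trans] by simp
    also have "\<dots> = monom x + const (c + d)"
      by (rule series_eqI) simp
    finally show ?thesis .
  qed
  have "bij_betw (\<lambda>h. coeff h 1) ?C UNIV"
    unfolding C
    by (rule bij_betw_byWitness[where f' = "\<lambda>c. monom x + const c"])
      (auto simp: coeff simp del: coeff_simps)
  then have "(\<lambda>h. coeff h 1) \<in> iso \<lparr>carrier = ?C, mult = cmp, one = monom x\<rparr>
      \<lparr>carrier = (UNIV :: 'r set), mult = (+), one = 0\<rparr>"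
    by (auto simp: iso_def hom_def C comp_trans coeff simp del: coeff_simps)
  moreover have "\<forall>a\<in>?C. \<forall>b\<in>?C. a < b \<longleftrightarrow> coeff a 1 < coeff b 1"
    unfolding C
    by (auto simp: coeff add_left_less_iff_series const_less_iff simp del: coeff_simps)
  ultimately show ?thesis
    using grp grp_add by (simp add: ordered_group_iso_def)
qed


section \<open>Centralisers of arbitrary elements\<close>

theorem proposition4:
  fixes \<kappa> :: "'k rel"
    and lg D :: "('n::linordered_ab_group_mult, 'r::linordered_field) series \<Rightarrow> ('n, 'r) series"
    and cmp :: "('n, 'r) series \<Rightarrow> ('n, 'r) series \<Rightarrow> ('n, 'r) series"
    and x :: 'n and f :: "('n, 'r) series"
  assumes "regular_uncountable \<kappa>"
    and "exp_closed_transserial_field \<kappa> lg"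
    and "surjective_flat_transserial_derivation \<kappa> lg D x"
    and "H_field \<kappa> D"
    and "transserial_composition \<kappa> lg cmp x"
    and "flat_composition \<kappa> lg cmp"
    and "chain_rule \<kappa> D cmp"
    and "taylor_expansions \<kappa> D cmp"
    and "group (comp_monoid \<kappa> cmp x)"
    and "monotone_composition \<kappa> D cmp"
    and "\<And>g h. g \<in> pos_infinite \<kappa> \<Longrightarrow> h \<in> pos_infinite \<kappa> \<Longrightarrow> monom x < g \<Longrightarrow> monom x < h \<Longrightarrow>
           conjugate (comp_monoid \<kappa> cmp x) g h"
    and "f \<in> pos_infinite \<kappa>" and "f \<noteq> monom x"
  shows "\<exists>\<phi>. ordered_group_iso
    \<lparr>carrier = centraliser (comp_monoid \<kappa> cmp x) f, mult = cmp, one = monom x\<rparr>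
    \<lparr>carrier = (UNIV :: 'r set), mult = (+), one = 0\<rparr> \<phi>"
proof -
  let ?G = "comp_monoid \<kappa> cmp x"
  note \<kappa> = assms(1) and comp = assms(5) and G = assms(9)
  interpret group ?G by (rule G)
  have carr: "carrier ?G = pos_infinite \<kappa>" and m: "mult ?G = cmp" and e: "one ?G = monom x"
    by (simp_all add: comp_monoid_def)
  have x: "(monom x :: ('n, 'r) series) \<in> pos_infinite \<kappa>"
    using comp by (simp add: transserial_composition_def)
  have x1: "(monom x :: ('n, 'r) series) + 1 \<in> pos_infinite \<kappa>"
    using add_const_pos_infinite[OF \<kappa> x] by (simp add: one_series_def)
  \<comment> \<open>Either \<open>f\<close> or its inverse lies above the identity, and their centralisers coincide.\<close>
  obtain g where g: "g \<in> pos_infinite \<kappa>" "monom x < g" and Cg: "centraliser ?G g = centraliser ?G f"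
  proof (cases "monom x < f")
    case True
    then show ?thesis
      using that assms(12) by blast
  next
    case False
    then have "f < monom x"
      using less_linear_series[OF \<kappa>, of f "monom x"] assms(12,13) x by (auto simp: pos_infinite_def)
    have f: "f \<in> carrier ?G"
      using assms(12) by (simp add: carr)
    then have inv_f: "m_inv ?G f \<in> pos_infinite \<kappa>"
      using inv_closed by (simp add: carr)
    have "cmp f (m_inv ?G f) < cmp (monom x) (m_inv ?G f)"
      by (rule comp_right_strict_mono[OF comp G assms(12) x inv_f \<open>f < monom x\<close>])
    then have "monom x < m_inv ?G f"
      using r_inv[OF f] comp_identity[OF comp inv_f] by (simp add: m e)
    then show ?thesis
      using that inv_f centraliser_inv[OF f] by blast
  qed
  have "conjugate ?G g (monom x + 1)"
    using assms(11) g x1 less_add_one_series by blast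
  then obtain \<phi> where "ordered_group_iso
      \<lparr>carrier = centraliser ?G g, mult = cmp, one = monom x\<rparr>
      \<lparr>carrier = centraliser ?G (monom x + 1), mult = cmp, one = monom x\<rparr> \<phi>"
    using conjugate_centralisers_ordered_iso[OF G, of g "monom x + 1"] g x1
      comp_left_strict_mono[OF assms(4,10)] comp_right_strict_mono[OF comp G]
    unfolding carr m e by blast
  then show ?thesis
    using ordered_group_iso_trans
      centraliser_translation_ordered_iso[OF \<kappa> assms(3,4) comp assms(7) G assms(10)]
    unfolding Cg by blast
qed

end
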